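(* Let $n\ge 3$, let $A\subseteq\{1,\dots,n\}$ be nonempty and $a=\min(A)$. A position $\mathbf p=(p_1,\dots,p_n)$ of $SN(n,A)$, with $p_n=\max_i p_i$, is reduced if and only if $p_n\le \Sigma(\mathbf p)/a$.
   Context: For an integer $n\ge 1$ and a nonempty set $A\subseteq\{1,\dots,n\}$, the game $SN(n,A)$ is played on $n$ stacks of tokens; a position is $\mathbf p=(p_1,\dots,p_n)$ of nonnegative integers, in non-decreasing order so $p_n=\max_i p_i$. A move consists of choosing some $\ell\in A$ and $\ell$ distinct stacks, each of height at least $1$, and removing exactly one token from each. $\Sigma(\mathbf p)=\sum_i p_i$. A terminal position is one with no legal move. For a position $\mathbf p$, let $\mathcal T(\mathbf p)$ be the set of terminal positions reachable from $\mathbf p$ by finite sequences of legal moves, $u_i(\mathbf p)=\min\{t_i:\mathbf t\in\mathcal T(\mathbf p)\}$, and $r(\mathbf p)=\mathbf p-u(\mathbf p)$. The position $\mathbf p$ is reduced if $r(\mathbf p)=\mathbf p$. *)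

theory Defs
  imports Complex_Main
begin

text \<open>
  A tuple \<open>(p\<^sub>1, \<dots>, p\<^sub>n)\<close> of stack heights is encoded as \<open>p :: nat \<Rightarrow> nat\<close>, of which only the
  values on \<open>{1..n}\<close> matter (moves leave the other values unchanged). The initial position is
  listed in non-decreasing order, but stacks keep their labels during play: the tuple is not
  re-sorted after a move. Hence \<open>t i\<close>, for \<open>t\<close> reachable from \<open>p\<close>, is the number of
  tokens left on the very stack that had height \<open>p i\<close>, and \<open>p - u(p)\<close> is meaningful stack by stack.
  (With re-sorting, \<open>(1,1,1)\<close> in \<open>SN(3,{2})\<close> would only reach \<open>(0,0,1)\<close> and would not be reduced.)
\<close>

definition sorted_position :: "nat \<Rightarrow> (nat \<Rightarrow> nat) \<Rightarrow> bool" where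
  "sorted_position n p \<longleftrightarrow> mono_on {1..n} p"

definition tokens :: "nat \<Rightarrow> (nat \<Rightarrow> nat) \<Rightarrow> nat" where
  "tokens n p = (\<Sum>i=1..n. p i)"

definition move :: "nat \<Rightarrow> nat set \<Rightarrow> (nat \<Rightarrow> nat) \<Rightarrow> (nat \<Rightarrow> nat) \<Rightarrow> bool" where
  "move n A p q \<longleftrightarrow>
     (\<exists>S \<subseteq> {1..n}. card S \<in> A \<and> (\<forall>i\<in>S. 1 \<le> p i) \<and> q = (\<lambda>i. if i \<in> S then p i - 1 else p i))"

definition terminal :: "nat \<Rightarrow> nat set \<Rightarrow> (nat \<Rightarrow> nat) \<Rightarrow> bool" where
  "terminal n A p \<longleftrightarrow> (\<nexists>q. move n A p q)"

definition terminals_from :: "nat \<Rightarrow> nat set \<Rightarrow> (nat \<Rightarrow> nat) \<Rightarrow> (nat \<Rightarrow> nat) set" where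
  "terminals_from n A p = {t. (move n A)\<^sup>*\<^sup>* p t \<and> terminal n A t}"

text \<open>
  For \<open>A \<subseteq> {1..n}\<close> the set under \<open>Min\<close> is nonempty (every move removes a token) and is bounded by
  \<open>p i\<close>; so \<open>Min\<close> is a genuine minimum and the subtraction in \<open>reduction\<close> does not truncate.
\<close>

definition unusable :: "nat \<Rightarrow> nat set \<Rightarrow> (nat \<Rightarrow> nat) \<Rightarrow> nat \<Rightarrow> nat" where
  "unusable n A p i = Min {t i | t. t \<in> terminals_from n A p}"

definition reduction :: "nat \<Rightarrow> nat set \<Rightarrow> (nat \<Rightarrow> nat) \<Rightarrow> nat \<Rightarrow> nat" where
  "reduction n A p i = p i - unusable n A p i"

definition reduced :: "nat \<Rightarrow> nat set \<Rightarrow> (nat \<Rightarrow> nat) \<Rightarrow> bool" where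
  "reduced n A p \<longleftrightarrow> (\<forall>i\<in>{1..n}. reduction n A p i = p i)"

end

theory Submission
  imports Defs
begin

text \<open>
  Play ends after finitely many moves and an emptied stack stays empty, so \<open>p\<close> is reduced iff each
  stack \<open>i\<close> can be emptied. Every move that lowers stack \<open>i\<close> removes at least \<open>a\<close> tokens in
  total, which forces \<open>a * p n \<le> \<Sigma>\<close>. Conversely, \<open>i\<close> can be emptied in \<open>p i\<close> moves of size
  \<open>a\<close> as soon as \<open>a * p i \<le> (\<Sum>j. min (p j) (p i))\<close>, and this holds for every \<open>i\<close> once
  \<open>a * p n \<le> \<Sigma>\<close>, because \<open>p j * m \<le> min (p j) m * p n\<close> whenever \<open>p j, m \<le> p n\<close>.
\<close>

lemma move_le: "move n A p q \<Longrightarrow> q i \<le> p i"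
  by (auto simp: move_def)

lemma moves_le: "(move n A)\<^sup>*\<^sup>* p q \<Longrightarrow> q i \<le> p i"
  by (induction rule: rtranclp_induct) (auto dest: move_le intro: le_trans)

text \<open>The additive form keeps truncated subtraction out of later sums and linear
  arithmetic.\<close>

lemma move_tokens:
  assumes "move n A p q"
  obtains S where "S \<subseteq> {1..n}" "card S \<in> A" "tokens n p = tokens n q + card S"
    "\<And>i. p i = q i + of_bool (i \<in> S)"
proof -
  obtain S where S: "S \<subseteq> {1..n}" "card S \<in> A" "\<forall>i\<in>S. 1 \<le> p i"
    and q: "q = (\<lambda>i. if i \<in> S then p i - 1 else p i)"
    using assms unfolding move_def by blast
  have eq: "p i = q i + of_bool (i \<in> S)" for i
    using S(3) by (auto simp: q)
  have "tokens n p = (\<Sum>i=1..n. q i + of_bool (i \<in> S))"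
    unfolding tokens_def using eq by (intro sum.cong) auto
  also have "\<dots> = tokens n q + (\<Sum>i=1..n. of_bool (i \<in> S))"
    by (simp add: tokens_def sum.distrib)
  also have "(\<Sum>i=1..n. of_bool (i \<in> S)) = card S"
    using S(1) by (simp add: Int_absorb1 flip: Int_def)
  finally show thesis using that S eq by blast
qed

text \<open>Invariant: \<open>tokens n p - a * p i\<close>, read over the integers, never increases.
  A move using stack \<open>i\<close> lowers \<open>a * p i\<close> by exactly \<open>a\<close> and
  the total by at least \<open>a\<close>; any other move only lowers the total.\<close>

lemma moves_tokens:
  assumes "(move n A)\<^sup>*\<^sup>* p q" and "\<And>l. l \<in> A \<Longrightarrow> a \<le> l"
  shows "a * p i + tokens n q \<le> tokens n p + a * q i"
  using assms(1)
proof (induction rule: rtranclp_induct)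
  case base
  then show ?case by simp
next
  case (step q r)
  from step.hyps(2) obtain S where S: "card S \<in> A" "tokens n q = tokens n r + card S"
    "q i = r i + of_bool (i \<in> S)" by (metis move_tokens)
  have "a * q i \<le> a * r i + card S"
    using assms(2)[OF S(1)] by (simp add: S(3) algebra_simps of_bool_def)
  then show ?case using step.IH S(2) by linarith
qed

lemma terminal_reachable:
  assumes "0 \<notin> A"
  obtains t where "(move n A)\<^sup>*\<^sup>* p t" "terminal n A t"
proof -
  have "\<exists>t. (move n A)\<^sup>*\<^sup>* p t \<and> terminal n A t"
  proof (induction "tokens n p" arbitrary: p rule: less_induct)
    case less
    show ?case
    proof (cases "terminal n A p")
      case False
      then obtain q where q: "move n A p q" by (auto simp: terminal_def)
      obtain S :: "nat set" where "card S \<in> A" "tokens n p = tokens n q + card S"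
        using q by (elim move_tokens) blast
      \<comment> \<open>\<open>0 \<notin> A\<close> rules out the empty move, so the total strictly
        drops.\<close>
      with assms have "tokens n q < tokens n p" by (cases "card S = 0") auto
      with less q show ?thesis by (meson converse_rtranclp_into_rtranclp)
    qed auto
  qed
  then show thesis using that by blast
qed

lemma unusable_eq_0_iff:
  assumes "0 \<notin> A"
  shows "unusable n A p i = 0 \<longleftrightarrow> (\<exists>q. (move n A)\<^sup>*\<^sup>* p q \<and> q i = 0)"
proof -
  let ?U = "{t i | t. t \<in> terminals_from n A p}"
  have "?U \<subseteq> {..p i}"
    by (auto simp: terminals_from_def moves_le)
  then have fin: "finite ?U" by (rule finite_subset) simp
  have ne: "?U \<noteq> {}"
    using terminal_reachable[OF assms, of n p] by (auto simp: terminals_from_def)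
  have "unusable n A p i = 0 \<longleftrightarrow> 0 \<in> ?U"
    unfolding unusable_def using fin ne Min_in[OF fin ne] Min_le[OF fin, of 0] by auto
  also have "\<dots> \<longleftrightarrow> (\<exists>q. (move n A)\<^sup>*\<^sup>* p q \<and> q i = 0)"
  proof
    assume "\<exists>q. (move n A)\<^sup>*\<^sup>* p q \<and> q i = 0"
    then obtain q where q: "(move n A)\<^sup>*\<^sup>* p q" "q i = 0" by blast
    obtain t where t: "(move n A)\<^sup>*\<^sup>* q t" "terminal n A t"
      using terminal_reachable[OF assms] .
    have "t i = 0" using moves_le[OF t(1), of i] q(2) by simp
    with q t show "0 \<in> ?U"
      by (force simp: terminals_from_def)
  qed (force simp: terminals_from_def)
  finally show ?thesis .
qed

lemma reduced_iff:
  assumes "0 \<notin> A"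
  shows "reduced n A p \<longleftrightarrow> (\<forall>i\<in>{1..n}. \<exists>q. (move n A)\<^sup>*\<^sup>* p q \<and> q i = 0)"
proof -
  \<comment> \<open>The truncated difference equals \<open>p i\<close> also when
    \<open>p i = 0\<close>; then \<open>p\<close> itself is the required \<open>q\<close>.\<close>
  have "reduction n A p i = p i \<longleftrightarrow> (\<exists>q. (move n A)\<^sup>*\<^sup>* p q \<and> q i = 0)" for i
    using unusable_eq_0_iff[OF assms, of n p i]
    by (cases "p i = 0") (auto simp: reduction_def)
  then show ?thesis by (simp add: reduced_def)
qed

text \<open>
  Only \<open>min (p j) (p i)\<close> tokens of stack \<open>j\<close> can help to empty stack \<open>i\<close>. Taking tokens
  from stacks of height at least \<open>p i\<close> first keeps the hypothesis true after the move.
\<close>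

lemma can_empty:
  assumes "a \<in> A" "0 < a" "i \<in> {1..n}" "a * p i \<le> (\<Sum>j=1..n. min (p j) (p i))"
  shows "\<exists>q. (move n A)\<^sup>*\<^sup>* p q \<and> q i = 0"
  using assms(4)
proof (induction "p i" arbitrary: p)
  case 0
  then show ?case by (metis rtranclp.rtrancl_refl)
next
  case (Suc m)
  define B where "B = {j\<in>{1..n}. p i \<le> p j}"
  define D where "D = {j\<in>{1..n}. 1 \<le> p j}"
  define after where "after S j = (if j \<in> S then p j - 1 else p j)" for S j
  have fin: "finite B" "finite D" by (auto simp: B_def D_def)
  have iB: "i \<in> B" using assms(3) by (simp add: B_def)
  have BD: "B \<subseteq> D" using Suc.hyps by (auto simp: B_def D_def)
  have "\<exists>S. i \<in> S \<and> S \<subseteq> D \<and> card S = a \<and> a * m \<le> (\<Sum>j=1..n. min (after S j) m)"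
  proof (cases "a \<le> card B")
    case True
    then obtain S where S: "{i} \<subseteq> S" "S \<subseteq> B" "card S = a"
      using exists_subset_between[of "{i}" a B] iB assms(2) fin by auto
    \<comment> \<open>Stacks of \<open>B\<close> have height at least \<open>m + 1\<close> and lose
      at most one token, so each still contributes \<open>m\<close>; \<open>B\<close> alone
      suffices.\<close>
    have "a * m \<le> (\<Sum>j\<in>B. m)" using True by simp
    also have "\<dots> \<le> (\<Sum>j\<in>B. min (after S j) m)"
      using Suc.hyps by (intro sum_mono) (auto simp: B_def after_def)
    also have "\<dots> \<le> (\<Sum>j=1..n. min (after S j) m)"
      by (intro sum_mono2) (auto simp: B_def)
    finally show ?thesis using S BD by blast
  next
    case False
    \<comment> \<open>Each nonempty stack contributes at most \<open>p i\<close>, so at least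
      \<open>a\<close> stacks are nonempty and \<open>B\<close> extends to a legal choice
      \<open>S\<close>.\<close>
    have "a * p i \<le> (\<Sum>j=1..n. min (p j) (p i))" by (rule Suc.prems)
    also have "\<dots> = (\<Sum>j\<in>D. min (p j) (p i))"
      by (intro sum.mono_neutral_right) (auto simp: D_def)
    also have "\<dots> \<le> (\<Sum>j\<in>D. p i)" by (intro sum_mono) simp
    finally have "a \<le> card D" using Suc.hyps by (metis mult_le_cancel2 of_nat_id sum_constant zero_less_Suc)
    then obtain S where S: "B \<subseteq> S" "S \<subseteq> D" "card S = a"
      using exists_subset_between[of B a D] False BD fin by auto
    have "a * m + a = a * p i" using Suc.hyps by (metis mult_Suc_right add.commute)
    also note Suc.prems
    \<comment> \<open>Outside \<open>S\<close> heights are at most \<open>m\<close>, as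
      \<open>B \<subseteq> S\<close>, so lowering the cap to \<open>m\<close> costs nothing; inside
      \<open>S\<close> each term loses at most one. The total loss is at most \<open>a\<close>, the
      drop from \<open>a * p i\<close> to \<open>a * m\<close>.\<close>
    also have "(\<Sum>j=1..n. min (p j) (p i)) \<le> (\<Sum>j=1..n. min (after S j) m + of_bool (j \<in> S))"
      using Suc.hyps S(1) by (intro sum_mono) (auto simp: after_def B_def not_le)
    also have "\<dots> = (\<Sum>j=1..n. min (after S j) m) + a"
    proof -
      have "S \<subseteq> {1..n}" using S(2) by (auto simp: D_def)
      then show ?thesis using S(3) by (simp add: sum.distrib Int_absorb1 flip: Int_def)
    qed
    finally show ?thesis using S iB by auto
  qed
  then obtain S where S: "i \<in> S" "S \<subseteq> D" "card S = a"
    and sum: "a * m \<le> (\<Sum>j=1..n. min (after S j) m)" by blast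
  have m: "m = after S i" using S(1) Suc.hyps by (simp add: after_def)
  have "move n A p (after S)"
    unfolding move_def after_def using S assms(1) by (intro exI[of _ S]) (auto simp: D_def)
  moreover have "\<exists>q. (move n A)\<^sup>*\<^sup>* (after S) q \<and> q i = 0"
    by (rule Suc.hyps(1)[of "after S", OF m, folded m, OF sum])
  ultimately show ?case by (meson converse_rtranclp_into_rtranclp)
qed

theorem theorem3:
  fixes n :: nat and A :: "nat set" and p :: "nat \<Rightarrow> nat"
  assumes "n \<ge> 3"
    and "A \<noteq> {}" and "A \<subseteq> {1..n}"
    and "sorted_position n p"
  shows "reduced n A p \<longleftrightarrow> real (p n) \<le> real (tokens n p) / real (Min A)"
proof -
  define a where "a = Min A"
  have fin: "finite A" using assms(3) finite_subset by blast
  have aA: "a \<in> A" using fin assms(2) by (simp add: a_def)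
  have a_le: "\<And>l. l \<in> A \<Longrightarrow> a \<le> l" using fin by (simp add: a_def)
  have A0: "0 \<notin> A" using assms(3) by auto
  with aA have a0: "0 < a" by (cases a) auto
  have "real (p n) \<le> real (tokens n p) / real a \<longleftrightarrow> real (a * p n) \<le> real (tokens n p)"
    using a0 by (simp add: field_simps)
  also have "\<dots> \<longleftrightarrow> a * p n \<le> tokens n p" by (rule of_nat_le_iff)
  also have "\<dots> \<longleftrightarrow> reduced n A p"
    unfolding reduced_iff[OF A0]
  proof
    assume "\<forall>i\<in>{1..n}. \<exists>q. (move n A)\<^sup>*\<^sup>* p q \<and> q i = 0"
    moreover have "n \<in> {1..n}" using assms(1) by simp
    ultimately obtain q where q: "(move n A)\<^sup>*\<^sup>* p q" "q n = 0" by blast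
    show "a * p n \<le> tokens n p"
      using moves_tokens[OF q(1) a_le, of n] q(2) by simp
  next
    assume le: "a * p n \<le> tokens n p"
    have max: "p j \<le> p n" if "j \<in> {1..n}" for j
      using assms(4) that unfolding sorted_position_def by (auto intro: mono_onD)
    show "\<forall>i\<in>{1..n}. \<exists>q. (move n A)\<^sup>*\<^sup>* p q \<and> q i = 0"
    proof
      fix i assume i: "i \<in> {1..n}"
      have "(a * p i) * p n \<le> tokens n p * p i"
        using mult_right_mono[OF le, of "p i"] by (simp add: ac_simps)
      also have "\<dots> = (\<Sum>j=1..n. p j * p i)" by (simp add: tokens_def sum_distrib_right)
      also have "\<dots> \<le> (\<Sum>j=1..n. min (p j) (p i) * p n)"
      proof (rule sum_mono)
        fix j assume "j \<in> {1..n}"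
        \<comment> \<open>A product of two numbers is their minimum times their maximum, and the
          maximum is at most \<open>p n\<close>.\<close>
        then show "p j * p i \<le> min (p j) (p i) * p n"
          using max[of j] max[OF i] by (auto simp: min_def mult.commute intro: mult_le_mono)
      qed
      also have "\<dots> = (\<Sum>j=1..n. min (p j) (p i)) * p n" by (simp add: sum_distrib_right)
      \<comment> \<open>A positive \<open>p n\<close> cancels; \<open>p n = 0\<close> forces
        \<open>p i = 0\<close>.\<close>
      finally have "a * p i \<le> (\<Sum>j=1..n. min (p j) (p i))"
        using max[OF i] by (cases "p n = 0") auto
      then show "\<exists>q. (move n A)\<^sup>*\<^sup>* p q \<and> q i = 0"
        using can_empty aA a0 i by blast
    qed
  qed
  finally show ?thesis unfolding a_def by blast
qed

end
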